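(* Let $p\in(0,1)$, $\eta,\beta_l,\beta_e>0$, $\lambda_l,\lambda_e\ge 0$ with $\lambda_l p\beta_l^2+\lambda_e\beta_e^2>0$. Consider the network of legitimate nodes and eavesdroppers distributed as independent Poisson point processes in $\mathbb{R}^2$ with densities $\lambda_l$ and $\lambda_e$, the legitimate nodes employing slotted ALOHA with transmission probability $p$, at a fixed time slot. Place a receiving legitimate node at the origin $0$ (typical node), and let $$N_{r,0}=\sum_{y\in\Phi_t}\mathbf{1}\{y\stackrel{(1)}{\rightarrow}0\}\,\mathbf{1}\{\text{no eavesdropper in }\mathbb{B}(y,\beta_e\|y\|)\}$$ be its secure in-degree. Then $$\mathbb{E}N_{r,0}=\frac{\lambda_l p\left[1-\exp\left(-(\lambda_l p\beta_l^2+\lambda_e\beta_e^2)\pi\eta^2\right)\right]}{\lambda_l p\beta_l^2+\lambda_e\beta_e^2}.$$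
   Context: $\mathbb{B}(x,r)$ denotes the disk in $\mathbb{R}^2$ centred at $x$ of radius $r$; $\|\cdot\|$ is the Euclidean norm. Legitimate nodes $\Phi_l$ and eavesdroppers $\Phi_e$ are independent homogeneous Poisson point processes on $\mathbb{R}^2$ with densities $\lambda_l$ and $\lambda_e$. In a given slot each legitimate node independently transmits with probability $p$ (set $\Phi_t$) and otherwise receives (set $\Phi_r=\Phi_l\setminus\Phi_t$). For a transmitter $x$ and a receiver $y$, $\mathbf{1}\{x\stackrel{(1)}{\rightarrow}y\}=1$ (single-hop connectivity without the security constraint) if and only if (C1) $\|x-y\|<\eta$ and (C2) the disk $\mathbb{B}(y,\beta_l\|x-y\|)$ contains no transmitting node other than $x$. The expectation is for a typical node: a receiving node is added at the origin to the Poisson process $\Phi_l$. *)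

theory Defs
  imports "HOL-Probability.Probability"
begin

text \<open>Realisations of a simple point process are locally finite sets; they carry the sigma-algebra
  generated by the numbers of points in the bounded Borel sets.\<close>

definition configurations :: "'a::euclidean_space set set" where
  "configurations = {A. \<forall>B. bounded B \<longrightarrow> finite (A \<inter> B)}"

definition config_space :: "'a::euclidean_space set measure" where
  "config_space = sigma configurations
     {{A \<in> configurations. card (A \<inter> B) = n} | B n. B \<in> sets borel \<and> bounded B}"

text \<open>The Poisson probabilities are written out, because \<^const>\<open>poisson_pmf\<close> requires a positive
  rate, whereas here \<open>lam\<close> and the measure of \<open>B\<close> may be \<open>0\<close> (and then \<open>0 ^ 0 = 1\<close> gives the point
  mass at \<open>0\<close>).\<close>

definition (in prob_space) poisson_process :: "real \<Rightarrow> ('a \<Rightarrow> 'b::euclidean_space set) \<Rightarrow> bool" where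
  "poisson_process lam \<Phi> \<longleftrightarrow>
     random_variable config_space \<Phi> \<and>
     (\<forall>B n. B \<in> sets borel \<and> bounded B \<longrightarrow>
        prob {\<omega> \<in> space M. card (\<Phi> \<omega> \<inter> B) = n} =
          exp (- (lam * measure lborel B)) * (lam * measure lborel B) ^ n / fact n) \<and>
     (\<forall>B (k::nat). (\<forall>i<k. B i \<in> sets borel \<and> bounded (B i)) \<and> disjoint_family_on B {..<k} \<longrightarrow>
        indep_vars (\<lambda>_. count_space UNIV) (\<lambda>i \<omega>. card (\<Phi> \<omega> \<inter> B i)) {..<k})"

text \<open>\<open>X i\<close>, for \<open>i < K\<close>, is a measurable enumeration without repetition of the points of \<open>\<Phi>\<close>;
  \<open>K\<close> is their (finite or infinite) number.\<close>

definition enumerates ::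
  "'w measure \<Rightarrow> ('w \<Rightarrow> enat) \<Rightarrow> (nat \<Rightarrow> 'w \<Rightarrow> 'b::euclidean_space) \<Rightarrow> ('w \<Rightarrow> 'b set) \<Rightarrow> bool" where
  "enumerates M K X \<Phi> \<longleftrightarrow>
     K \<in> M \<rightarrow>\<^sub>M count_space UNIV \<and>
     (\<forall>i. X i \<in> M \<rightarrow>\<^sub>M borel) \<and>
     (\<forall>\<omega>\<in>space M. bij_betw (\<lambda>i. X i \<omega>) {i. enat i < K \<omega>} (\<Phi> \<omega>))"

text \<open>Independent random variables with values in possibly different types
  (\<^const>\<open>prob_space.indep_var\<close> only covers equal types).\<close>

definition (in prob_space) independent_rvs ::
  "'b measure \<Rightarrow> ('a \<Rightarrow> 'b) \<Rightarrow> 'c measure \<Rightarrow> ('a \<Rightarrow> 'c) \<Rightarrow> bool" where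
  "independent_rvs S Y S' Z \<longleftrightarrow>
     random_variable S Y \<and> random_variable S' Z \<and>
     indep_set {Y -` A \<inter> space M | A. A \<in> sets S} {Z -` A \<inter> space M | A. A \<in> sets S'}"

text \<open>Slotted ALOHA in one slot: \<open>T i\<close> says whether the \<open>i\<close>-th legitimate node transmits. The marks
  are i.i.d., and independent of everything else, that is, of the (labelled) legitimate nodes
  and the eavesdroppers jointly.\<close>

definition (in prob_space) aloha_marks ::
  "real \<Rightarrow> (nat \<Rightarrow> 'a \<Rightarrow> bool) \<Rightarrow> ('a \<Rightarrow> enat) \<Rightarrow> (nat \<Rightarrow> 'a \<Rightarrow> 'b::euclidean_space) \<Rightarrow>
   ('a \<Rightarrow> 'b set) \<Rightarrow> bool" where
  "aloha_marks p T K X \<Phi>e \<longleftrightarrow>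
     indep_vars (\<lambda>_. count_space UNIV) T UNIV \<and>
     (\<forall>i. distr M (count_space UNIV) (T i) = measure_pmf (bernoulli_pmf p)) \<and>
     independent_rvs
       (\<Pi>\<^sub>M i\<in>UNIV. count_space UNIV) (\<lambda>\<omega> i. T i \<omega>)
       (count_space UNIV \<Otimes>\<^sub>M (\<Pi>\<^sub>M i\<in>UNIV. borel) \<Otimes>\<^sub>M config_space) (\<lambda>\<omega>. (K \<omega>, \<lambda>i. X i \<omega>, \<Phi>e \<omega>))"

definition transmitters ::
  "('w \<Rightarrow> enat) \<Rightarrow> (nat \<Rightarrow> 'w \<Rightarrow> 'b) \<Rightarrow> (nat \<Rightarrow> 'w \<Rightarrow> bool) \<Rightarrow> 'w \<Rightarrow> 'b set" where
  "transmitters K X T \<omega> = {X i \<omega> | i. enat i < K \<omega> \<and> T i \<omega>}"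

definition single_hop :: "real \<Rightarrow> real \<Rightarrow> 'b::euclidean_space set \<Rightarrow> 'b \<Rightarrow> 'b \<Rightarrow> bool" where
  "single_hop \<eta> \<beta>l \<Phi>t x y \<longleftrightarrow>
     norm (x - y) < \<eta> \<and> (\<forall>z\<in>\<Phi>t. z \<noteq> x \<longrightarrow> z \<notin> ball y (\<beta>l * norm (x - y)))"

text \<open>Secure in-degree of a receiving node \<open>x\<close>. Being a receiver, \<open>x\<close> does not belong to \<open>\<Phi>t\<close>, so
  adding it to the network does not change \<open>\<Phi>t\<close>. The set \<open>\<Phi>t\<close> may be infinite, hence
  the unordered infinite sum (only finitely many terms are nonzero when \<open>\<Phi>t\<close> is locally finite).\<close>

definition secure_in_degree ::
  "real \<Rightarrow> real \<Rightarrow> real \<Rightarrow> 'b::euclidean_space set \<Rightarrow> 'b set \<Rightarrow> 'b \<Rightarrow> real" where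
  "secure_in_degree \<eta> \<beta>l \<beta>e \<Phi>t \<Phi>e x =
     (\<Sum>\<^sub>\<infinity>y\<in>\<Phi>t. of_bool (single_hop \<eta> \<beta>l \<Phi>t y x) * of_bool (\<Phi>e \<inter> ball y (\<beta>e * norm (y - x)) = {}))"

end

theory Submission
  imports Defs
begin

text \<open>Cut the disk of radius \<open>\<eta>\<close> into the cells of a fine grid. Up to discretisation, the secure
  in-degree is the sum over the cells of the number of transmitters in the cell, restricted to the
  events that the rest of a disk about the origin contains no transmitter and that a disk about the
  cell contains no eavesdropper. Given all positions the marks are independent, and the numbers of
  nodes in disjoint sets are independent Poisson variables, so each summand has an explicit
  expectation, and the sum of these is the integral of a step function. Dominated convergence on
  both sides replaces the Campbell-Mecke formula; the limit is the integral over the disk of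
  \<open>\<lambda>\<^sub>l p exp (- (\<lambda>\<^sub>l p \<beta>\<^sub>l\<^sup>2 + \<lambda>\<^sub>e \<beta>\<^sub>e\<^sup>2) \<pi> \<parallel>y\<parallel>\<^sup>2)\<close>.\<close>

section \<open>Counting variables and independence\<close>

lemma space_config_space [simp]: "space config_space = configurations"
  by (auto simp: config_space_def space_measure_of_conv)

lemma finite_configuration_Int:
  assumes "A \<in> configurations" "bounded B"
  shows "finite (A \<inter> B)"
  using assms by (auto simp: configurations_def)

text \<open>The sigma-algebra of \<open>config_space\<close> is generated by counts, so void events
  are expressed through \<open>card\<close>. Local finiteness enters because \<open>card\<close> is
  also 0 on infinite sets.\<close>

lemma config_disjoint_iff:
  assumes "A \<in> configurations" "bounded D"
  shows "A \<inter> D = {} \<longleftrightarrow> card (A \<inter> D) = 0"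
  using finite_configuration_Int[OF assms] by auto

lemma measurable_card_Int:
  assumes "B \<in> sets borel" "bounded B"
  shows "(\<lambda>A. card (A \<inter> B)) \<in> config_space \<rightarrow>\<^sub>M count_space UNIV"
proof (subst measurable_count_space_eq2_countable, safe)
  fix n
  have "(\<lambda>A. card (A \<inter> B)) -` {n} \<inter> space config_space
      = {A \<in> configurations. card (A \<inter> B) = n}" by auto
  also have "\<dots> \<in> sets config_space"
    unfolding config_space_def using assms by (subst sets_measure_of) auto
  finally show "(\<lambda>A. card (A \<inter> B)) -` {n} \<inter> space config_space \<in> sets config_space" .
qed auto

lemma suminf_of_bool:
  assumes "finite {i::nat. P i}"
  shows "(\<Sum>i. of_bool (P i)) = (of_nat (card {i. P i}) :: ennreal)"
proof -
  have "(\<Sum>i. of_bool (P i)) = (\<Sum>i | P i. of_bool (P i) :: ennreal)"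
    using assms by (intro suminf_finite) auto
  also have "\<dots> = of_nat (card {i. P i})" by simp
  finally show ?thesis .
qed

lemma measurable_of_bool: "Measurable.pred N P \<Longrightarrow> (\<lambda>x. of_bool (P x)) \<in> N \<rightarrow>\<^sub>M borel"
  by (rule measurable_compose[of P]) auto

section \<open>Poisson expectations and product formulas\<close>

context prob_space
begin

lemma nn_integral_nat_valued:
  fixes N :: "'a \<Rightarrow> nat" and g :: "nat \<Rightarrow> real"
  assumes [measurable]: "N \<in> M \<rightarrow>\<^sub>M count_space UNIV"
    and g: "\<And>n. 0 \<le> g n" and s: "(\<lambda>n. g n * prob {\<omega> \<in> space M. N \<omega> = n}) sums s"
  shows "(\<integral>\<^sup>+\<omega>. ennreal (g (N \<omega>)) \<partial>M) = ennreal s"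
proof -
  have "(\<integral>\<^sup>+\<omega>. ennreal (g (N \<omega>)) \<partial>M)
      = (\<integral>\<^sup>+\<omega>. (\<Sum>n. ennreal (g n) * indicator {\<omega> \<in> space M. N \<omega> = n} \<omega>) \<partial>M)"
  proof (rule nn_integral_cong)
    fix \<omega> assume "\<omega> \<in> space M"
    then show "ennreal (g (N \<omega>)) = (\<Sum>n. ennreal (g n) * indicator {\<omega> \<in> space M. N \<omega> = n} \<omega>)"
      by (subst suminf_finite[of "{N \<omega>}"]) auto
  qed
  also have "\<dots> = (\<Sum>n. ennreal (g n) * emeasure M {\<omega> \<in> space M. N \<omega> = n})"
    by (subst nn_integral_suminf) (auto simp: nn_integral_cmult_indicator)
  also have "\<dots> = (\<Sum>n. ennreal (g n * prob {\<omega> \<in> space M. N \<omega> = n}))"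
    by (simp add: emeasure_eq_measure ennreal_mult g)
  also have "\<dots> = ennreal s"
    using s g by (intro suminf_ennreal_eq) auto
  finally show ?thesis .
qed

text \<open>Both values come from the exponential series. At \<open>q = 1 - p\<close> the generating
  function is the probability that all nodes of a set stay silent, that is, a void probability of
  the thinned process.\<close>

lemma
  fixes N :: "'a \<Rightarrow> nat" and \<mu> :: real
  assumes N: "N \<in> M \<rightarrow>\<^sub>M count_space UNIV"
    and prob: "\<And>n. prob {\<omega> \<in> space M. N \<omega> = n} = exp (- \<mu>) * \<mu> ^ n / fact n"
  shows poisson_mean: "(\<integral>\<^sup>+\<omega>. ennreal (real (N \<omega>)) \<partial>M) = ennreal \<mu>"
    and poisson_pgf: "0 \<le> q \<Longrightarrow> (\<integral>\<^sup>+\<omega>. ennreal (q ^ N \<omega>) \<partial>M) = ennreal (exp (- ((1 - q) * \<mu>)))"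
proof -
  have e: "(\<lambda>n. x ^ n / fact n) sums exp x" for x :: real
    using exp_converges[of x] by (simp add: divide_inverse mult.commute)
  have "(\<lambda>n. \<mu> * exp (- \<mu>) * (\<mu> ^ n / fact n)) sums (\<mu> * exp (- \<mu>) * exp \<mu>)"
    by (intro sums_mult e)
  also have "(\<lambda>n. \<mu> * exp (- \<mu>) * (\<mu> ^ n / fact n))
      = (\<lambda>n. real (Suc n) * (exp (- \<mu>) * \<mu> ^ Suc n / fact (Suc n)))"
    by (rule ext) (simp add: fact_Suc del: of_nat_Suc)
  also have "\<mu> * exp (- \<mu>) * exp \<mu> = \<mu>"
    by (simp add: mult.assoc flip: exp_add)
  finally have "(\<lambda>n. real (Suc n) * (exp (- \<mu>) * \<mu> ^ Suc n / fact (Suc n))) sums \<mu>" .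
  \<comment> \<open>The series so far starts at index 1; the added term at index 0 vanishes, so the
    sum is still \<open>\<mu>\<close>.\<close>
  from this[unfolded sums_Suc_iff[of "\<lambda>n. real n * (exp (- \<mu>) * \<mu> ^ n / fact n)"]]
  show "(\<integral>\<^sup>+\<omega>. ennreal (real (N \<omega>)) \<partial>M) = ennreal \<mu>"
    by (intro nn_integral_nat_valued N) (auto simp: prob)
  assume q: "0 \<le> q"
  have "(\<lambda>n. exp (- \<mu>) * ((q * \<mu>) ^ n / fact n)) sums (exp (- \<mu>) * exp (q * \<mu>))"
    by (intro sums_mult e)
  also have "(\<lambda>n. exp (- \<mu>) * ((q * \<mu>) ^ n / fact n))
      = (\<lambda>n. q ^ n * (exp (- \<mu>) * \<mu> ^ n / fact n))"
    by (rule ext) (simp add: power_mult_distrib)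
  also have "exp (- \<mu>) * exp (q * \<mu>) = exp (- ((1 - q) * \<mu>))"
    by (simp add: algebra_simps flip: exp_add)
  finally show "(\<integral>\<^sup>+\<omega>. ennreal (q ^ N \<omega>) \<partial>M) = ennreal (exp (- ((1 - q) * \<mu>)))"
    by (intro nn_integral_nat_valued N) (auto simp: prob q)
qed

text \<open>Independence makes the joint law a product measure, which is checked on rectangles;
  Tonelli then integrates over \<open>Y\<close> first. In the result \<open>Z \<omega>\<close> is
  frozen while \<open>Y\<close> is drawn from a fresh \<omega>', which takes the place of
  conditioning on \<open>Z\<close>.\<close>

lemma independent_rvs_nn_integral:
  assumes ind: "independent_rvs S Y S' Z" and f: "f \<in> borel_measurable (S \<Otimes>\<^sub>M S')"
  shows "(\<integral>\<^sup>+\<omega>. f (Y \<omega>, Z \<omega>) \<partial>M) = (\<integral>\<^sup>+\<omega>. \<integral>\<^sup>+\<omega>'. f (Y \<omega>', Z \<omega>) \<partial>M \<partial>M)"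
proof -
  have Y[measurable]: "random_variable S Y" and Z[measurable]: "random_variable S' Z"
    and set: "indep_set {Y -` A \<inter> space M | A. A \<in> sets S} {Z -` A \<inter> space M | A. A \<in> sets S'}"
    using ind by (auto simp: independent_rvs_def)
  interpret Y: prob_space "distr M S Y" by (rule prob_space_distr) fact
  interpret Z: prob_space "distr M S' Z" by (rule prob_space_distr) fact
  interpret YZ: pair_prob_space "distr M S Y" "distr M S' Z" ..
  have eq: "distr M S Y \<Otimes>\<^sub>M distr M S' Z = distr M (S \<Otimes>\<^sub>M S') (\<lambda>\<omega>. (Y \<omega>, Z \<omega>))"
  proof (rule pair_measure_eqI)
    fix A B assume "A \<in> sets (distr M S Y)" "B \<in> sets (distr M S' Z)"
    then have A: "A \<in> sets S" and B: "B \<in> sets S'" by auto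
    have "emeasure (distr M (S \<Otimes>\<^sub>M S') (\<lambda>\<omega>. (Y \<omega>, Z \<omega>))) (A \<times> B)
        = emeasure M ((\<lambda>\<omega>. (Y \<omega>, Z \<omega>)) -` (A \<times> B) \<inter> space M)"
      using A B by (intro emeasure_distr) auto
    also have "(\<lambda>\<omega>. (Y \<omega>, Z \<omega>)) -` (A \<times> B) \<inter> space M
        = (Y -` A \<inter> space M) \<inter> (Z -` B \<inter> space M)" by auto
    also have "emeasure M \<dots> = ennreal (prob (Y -` A \<inter> space M) * prob (Z -` B \<inter> space M))"
      unfolding emeasure_eq_measure
      by (subst indep_setD[OF set]) (use A B in auto)
    finally show "emeasure (distr M S Y) A * emeasure (distr M S' Z) B
        = emeasure (distr M (S \<Otimes>\<^sub>M S') (\<lambda>\<omega>. (Y \<omega>, Z \<omega>))) (A \<times> B)"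
      using A B by (simp add: emeasure_distr emeasure_eq_measure ennreal_mult)
  qed (auto intro!: Y.sigma_finite_measure Z.sigma_finite_measure sets_pair_measure_cong
    intro: Y.sigma_finite_measure_axioms Z.sigma_finite_measure_axioms)
  have "(\<integral>\<^sup>+\<omega>. f (Y \<omega>, Z \<omega>) \<partial>M) = integral\<^sup>N (distr M (S \<Otimes>\<^sub>M S') (\<lambda>\<omega>. (Y \<omega>, Z \<omega>))) f"
    by (subst nn_integral_distr) (use f in auto)
  also have "\<dots> = (\<integral>\<^sup>+z. \<integral>\<^sup>+y. f (y, z) \<partial>distr M S Y \<partial>distr M S' Z)"
    unfolding eq[symmetric]
    by (rule YZ.nn_integral_snd[symmetric]) (use f in \<open>simp cong: measurable_cong_sets\<close>)
  also have "\<dots> = (\<integral>\<^sup>+\<omega>. \<integral>\<^sup>+y. f (y, Z \<omega>) \<partial>distr M S Y \<partial>M)"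
  proof (rule nn_integral_distr[OF Z])
    have "f \<in> borel_measurable (distr M S Y \<Otimes>\<^sub>M S')"
      using f by (simp cong: measurable_cong_sets)
    then have "(\<lambda>(z, y). f (y, z)) \<in> borel_measurable (S' \<Otimes>\<^sub>M distr M S Y)"
      by (subst measurable_pair_swap_iff) simp
    then have "(\<lambda>z. \<integral>\<^sup>+y. f (y, z) \<partial>distr M S Y) \<in> borel_measurable S'"
      by (rule Y.borel_measurable_nn_integral)
    then show "(\<lambda>z. \<integral>\<^sup>+y. f (y, z) \<partial>distr M S Y) \<in> borel_measurable (distr M S' Z)"
      by simp
  qed
  also have "\<dots> = (\<integral>\<^sup>+\<omega>. \<integral>\<^sup>+\<omega>'. f (Y \<omega>', Z \<omega>) \<partial>M \<partial>M)"
  proof (rule nn_integral_cong)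
    fix \<omega> assume "\<omega> \<in> space M"
    then have "Z \<omega> \<in> space S'" by (rule measurable_space[OF Z])
    then show "(\<integral>\<^sup>+y. f (y, Z \<omega>) \<partial>distr M S Y) = (\<integral>\<^sup>+\<omega>'. f (Y \<omega>', Z \<omega>) \<partial>M)"
      by (intro nn_integral_distr Y measurable_compose[OF _ f]) simp
  qed
  finally show ?thesis .
qed

lemma indep_var_nn_integral_mult:
  fixes F G :: "'a \<Rightarrow> ennreal"
  assumes "indep_var borel F borel G"
  shows "(\<integral>\<^sup>+\<omega>. F \<omega> * G \<omega> \<partial>M) = (\<integral>\<^sup>+\<omega>. F \<omega> \<partial>M) * (\<integral>\<^sup>+\<omega>. G \<omega> \<partial>M)"
proof -
  have "case_bool borel borel = (\<lambda>_. borel :: ennreal measure)"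
    by (auto simp: fun_eq_iff split: bool.split)
  then have "indep_vars (\<lambda>_. borel) (case_bool F G) UNIV"
    using assms by (simp add: indep_var_def)
  then have "(\<integral>\<^sup>+\<omega>. (\<Prod>b\<in>UNIV. case_bool F G b \<omega>) \<partial>M) = (\<Prod>b\<in>UNIV. \<integral>\<^sup>+\<omega>. case_bool F G b \<omega> \<partial>M)"
    by (intro indep_vars_nn_integral) auto
  then show ?thesis by (simp add: UNIV_bool mult.commute)
qed

lemma prob_bernoulli_pattern:
  fixes T :: "'i \<Rightarrow> 'a \<Rightarrow> bool"
  assumes ind: "indep_vars (\<lambda>_. count_space UNIV) T UNIV"
    and T: "\<And>i. distr M (count_space UNIV) (T i) = measure_pmf (bernoulli_pmf p)"
    and p: "0 \<le> p" "p \<le> 1" and J: "finite J" "i \<notin> J"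
  shows "prob {\<omega> \<in> space M. T i \<omega> \<and> (\<forall>j\<in>J. \<not> T j \<omega>)} = p * (1 - p) ^ card J"
proof -
  have rv[measurable]: "T j \<in> M \<rightarrow>\<^sub>M count_space UNIV" for j
    using ind by (auto simp: indep_vars_def)
  have *: "prob (T j -` A \<inter> space M) = measure (measure_pmf (bernoulli_pmf p)) A" for j A
    by (subst T[symmetric, of j]) (simp add: measure_distr)
  \<comment> \<open>The truth value \<open>j = i\<close> is the mark demanded at \<open>j\<close>:
    true at \<open>i\<close>, false on \<open>J\<close>. Both demands thus become one finite
    intersection, to which independence applies.\<close>
  have "{\<omega> \<in> space M. T i \<omega> \<and> (\<forall>j\<in>J. \<not> T j \<omega>)}
      = (\<Inter>j\<in>insert i J. T j -` {j = i} \<inter> space M)"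
    using J by auto
  also have "prob \<dots> = (\<Prod>j\<in>insert i J. prob (T j -` {j = i} \<inter> space M))"
    using J by (intro indep_varsD[OF ind]) auto
  also have "\<dots> = p * (\<Prod>j\<in>J. prob (T j -` {j = i} \<inter> space M))"
    using J p by (subst prod.insert) (auto simp: * measure_pmf_single)
  also have "(\<Prod>j\<in>J. prob (T j -` {j = i} \<inter> space M)) = (\<Prod>j\<in>J. 1 - p)"
  proof (rule prod.cong)
    fix j assume "j \<in> J"
    then have "(j = i) = False" using J by auto
    then show "prob (T j -` {j = i} \<inter> space M) = 1 - p"
      using p by (simp add: * measure_pmf_single)
  qed simp
  finally show ?thesis by simp
qed

end

section \<open>Expectation for one cell\<close>

text \<open>The network lives in a Euclidean space of arbitrary dimension; the plane enters only
  when the limiting integral is evaluated.\<close>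

locale aloha_network = prob_space M for M :: "'w measure" +
  fixes p lam_l lam_e :: real
    and \<Phi>l \<Phi>e :: "'w \<Rightarrow> 'b::euclidean_space set"
    and K :: "'w \<Rightarrow> enat" and X :: "nat \<Rightarrow> 'w \<Rightarrow> 'b" and T :: "nat \<Rightarrow> 'w \<Rightarrow> bool"
  assumes p: "0 \<le> p" "p \<le> 1" and lam_l: "0 \<le> lam_l"
    and poisson_l: "poisson_process lam_l \<Phi>l"
    and poisson_e: "poisson_process lam_e \<Phi>e"
    and indep: "indep_var config_space \<Phi>l config_space \<Phi>e"
    and enum: "enumerates M K X \<Phi>l"
    and marks: "aloha_marks p T K X \<Phi>e"
begin

section \<open>Labels, points and measurability in the network\<close>

abbreviation "\<Phi>t \<equiv> transmitters K X T"

lemma measurable_network [measurable]: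
  "K \<in> M \<rightarrow>\<^sub>M count_space UNIV" "X i \<in> M \<rightarrow>\<^sub>M borel" "T i \<in> M \<rightarrow>\<^sub>M count_space UNIV"
  subgoal using enum unfolding enumerates_def by blast
  subgoal using enum unfolding enumerates_def by blast
  subgoal using marks unfolding aloha_marks_def indep_vars_def by blast
  done

lemma random_variable_config:
  "random_variable config_space \<Phi>l" "random_variable config_space \<Phi>e"
  using poisson_l poisson_e unfolding poisson_process_def by blast+

lemma configurations_network:
  assumes "\<omega> \<in> space M"
  shows "\<Phi>l \<omega> \<in> configurations" "\<Phi>e \<omega> \<in> configurations"
  using random_variable_config[THEN measurable_space, OF assms] by simp_all

lemma bij_betw_enum: "\<omega> \<in> space M \<Longrightarrow> bij_betw (\<lambda>i. X i \<omega>) {i. enat i < K \<omega>} (\<Phi>l \<omega>)"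
  using enum unfolding enumerates_def by blast

lemma transmitters_subset: "\<omega> \<in> space M \<Longrightarrow> \<Phi>t \<omega> \<subseteq> \<Phi>l \<omega>"
  using bij_betw_enum[THEN bij_betw_imp_surj_on] unfolding transmitters_def by blast

lemma transmitters_configuration: "\<omega> \<in> space M \<Longrightarrow> \<Phi>t \<omega> \<in> configurations"
  using finite_subset[OF Int_mono[OF transmitters_subset order_refl]]
    finite_configuration_Int[OF configurations_network(1)]
  by (simp add: configurations_def)

text \<open>The enumeration is injective, so counting points amounts to counting labels. Sums over
  random point sets thereby become series over fixed labels with measurable terms.\<close>

lemma
  assumes "\<omega> \<in> space M" "bounded B"
  shows finite_indices: "finite {i. enat i < K \<omega> \<and> X i \<omega> \<in> B}"
    and card_indices: "card {i. enat i < K \<omega> \<and> X i \<omega> \<in> B} = card (\<Phi>l \<omega> \<inter> B)"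
    and card_indices_transmitters:
      "card {i. enat i < K \<omega> \<and> X i \<omega> \<in> B \<and> T i \<omega>} = card (\<Phi>t \<omega> \<inter> B)"
proof -
  have inj: "inj_on (\<lambda>i. X i \<omega>) {i. enat i < K \<omega>}" and im: "\<Phi>l \<omega> = (\<lambda>i. X i \<omega>) ` {i. enat i < K \<omega>}"
    using bij_betw_enum[OF assms(1)] by (auto simp: bij_betw_def)
  have l: "(\<lambda>i. X i \<omega>) ` {i. enat i < K \<omega> \<and> X i \<omega> \<in> B} = \<Phi>l \<omega> \<inter> B"
    by (auto simp: im)
  have t: "(\<lambda>i. X i \<omega>) ` {i. enat i < K \<omega> \<and> X i \<omega> \<in> B \<and> T i \<omega>} = \<Phi>t \<omega> \<inter> B"
    by (auto simp: transmitters_def)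
  show "finite {i. enat i < K \<omega> \<and> X i \<omega> \<in> B}"
    using finite_configuration_Int[OF configurations_network(1)[OF assms(1)] assms(2)]
    by (intro finite_imageD[of "\<lambda>i. X i \<omega>"] inj_on_subset[OF inj]) (auto simp: l)
  show "card {i. enat i < K \<omega> \<and> X i \<omega> \<in> B} = card (\<Phi>l \<omega> \<inter> B)"
    unfolding l[symmetric] by (intro card_image[symmetric] inj_on_subset[OF inj]) auto
  show "card {i. enat i < K \<omega> \<and> X i \<omega> \<in> B \<and> T i \<omega>} = card (\<Phi>t \<omega> \<inter> B)"
    unfolding t[symmetric] by (intro card_image[symmetric] inj_on_subset[OF inj]) auto
qed

text \<open>In this form the void event consists of countably many conditions on labels, which shows
  its measurability and its dependence on the marks.\<close>

lemma transmitters_disjoint_iff: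
  "\<Phi>t \<omega> \<inter> R = {} \<longleftrightarrow> (\<forall>j. enat j < K \<omega> \<and> X j \<omega> \<in> R \<longrightarrow> \<not> T j \<omega>)"
  by (auto simp: transmitters_def)

lemma measurable_card:
  assumes "B \<in> sets borel" "bounded B"
  shows "(\<lambda>\<omega>. card (\<Phi>l \<omega> \<inter> B)) \<in> M \<rightarrow>\<^sub>M count_space UNIV"
    and "(\<lambda>\<omega>. card (\<Phi>e \<omega> \<inter> B)) \<in> M \<rightarrow>\<^sub>M count_space UNIV"
  by (intro measurable_compose[OF _ measurable_card_Int[OF assms]] random_variable_config)+

text \<open>Given the labelled nodes and the eavesdroppers, the finitely many marks that matter are
  independent.\<close>

lemma nn_integral_marks:
  assumes Q: "Q \<in> sets borel" and R: "R \<in> sets borel" "bounded R"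
    and D: "D \<in> sets borel" "bounded D" and QR: "Q \<inter> R = {}"
  shows "(\<integral>\<^sup>+\<omega>. of_bool (enat i < K \<omega> \<and> X i \<omega> \<in> Q \<and> T i \<omega> \<and> \<Phi>t \<omega> \<inter> R = {} \<and> \<Phi>e \<omega> \<inter> D = {}) \<partial>M)
    = (\<integral>\<^sup>+\<omega>. of_bool (enat i < K \<omega> \<and> X i \<omega> \<in> Q) *
        (ennreal (p * (1 - p) ^ card (\<Phi>l \<omega> \<inter> R)) * of_bool (\<Phi>e \<omega> \<inter> D = {})) \<partial>M)"
    (is "?lhs = ?rhs")
proof -
  \<comment> \<open>\<open>transmitters\<close> mixes marks and positions. The event is therefore
    rewritten as a function of the mark sequence and of the remaining data, the two arguments that
    \<open>aloha_marks\<close> declares independent.\<close>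
  define P where "P = (\<lambda>(t, k, x, \<phi>). enat i < k \<and> x i \<in> Q \<and> t i \<and>
    (\<forall>j. enat j < k \<and> x j \<in> R \<longrightarrow> \<not> t j) \<and> card (\<phi> \<inter> D) = 0)"
  let ?N1 = "\<Pi>\<^sub>M i\<in>(UNIV::nat set). count_space (UNIV::bool set)"
  let ?N2 = "count_space (UNIV::enat set) \<Otimes>\<^sub>M (\<Pi>\<^sub>M i\<in>(UNIV::nat set). (borel::'b measure)) \<Otimes>\<^sub>M
    (config_space :: 'b set measure)"
  have [measurable]: "(\<lambda>z. fst z j) \<in> ?N1 \<Otimes>\<^sub>M ?N2 \<rightarrow>\<^sub>M count_space UNIV"
    "(\<lambda>z. fst (snd z)) \<in> ?N1 \<Otimes>\<^sub>M ?N2 \<rightarrow>\<^sub>M count_space UNIV"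
    "(\<lambda>z. fst (snd (snd z)) j) \<in> ?N1 \<Otimes>\<^sub>M ?N2 \<rightarrow>\<^sub>M borel" for j
    by (auto intro!: measurable_compose[OF _ measurable_component_singleton[of j UNIV]])
  have [measurable]: "(\<lambda>z. card (snd (snd (snd z)) \<inter> D)) \<in> ?N1 \<Otimes>\<^sub>M ?N2 \<rightarrow>\<^sub>M count_space UNIV"
    by (rule measurable_compose[OF _ measurable_card_Int[OF D]]) simp
  note [measurable] = Q R(1)
  have "Measurable.pred (?N1 \<Otimes>\<^sub>M ?N2) P"
    unfolding P_def split_beta by measurable
  then have meas: "(\<lambda>z. of_bool (P z) :: ennreal) \<in> borel_measurable (?N1 \<Otimes>\<^sub>M ?N2)"
    by (rule measurable_of_bool)
  have ind: "independent_rvs ?N1 (\<lambda>\<omega> i. T i \<omega>) ?N2 (\<lambda>\<omega>. (K \<omega>, \<lambda>i. X i \<omega>, \<Phi>e \<omega>))"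
    using marks by (simp add: aloha_marks_def)
  have "?lhs = (\<integral>\<^sup>+\<omega>. of_bool (P (\<lambda>i. T i \<omega>, K \<omega>, \<lambda>i. X i \<omega>, \<Phi>e \<omega>)) \<partial>M)"
    using config_disjoint_iff[OF configurations_network(2) D(2)]
    by (intro nn_integral_cong) (simp add: P_def transmitters_disjoint_iff)
  also have "\<dots> = (\<integral>\<^sup>+\<omega>. \<integral>\<^sup>+\<omega>'. of_bool (P (\<lambda>i. T i \<omega>', K \<omega>, \<lambda>i. X i \<omega>, \<Phi>e \<omega>)) \<partial>M \<partial>M)"
    by (rule independent_rvs_nn_integral[OF ind meas])
  also have "\<dots> = ?rhs"
  proof (rule nn_integral_cong)
    fix \<omega> assume \<omega>: "\<omega> \<in> space M"
    define J where "J = {j. enat j < K \<omega> \<and> X j \<omega> \<in> R}"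
    have J: "finite J" "card J = card (\<Phi>l \<omega> \<inter> R)"
      unfolding J_def by (rule finite_indices card_indices; fact \<omega> R)+
    show "(\<integral>\<^sup>+\<omega>'. of_bool (P (\<lambda>i. T i \<omega>', K \<omega>, \<lambda>i. X i \<omega>, \<Phi>e \<omega>)) \<partial>M)
      = of_bool (enat i < K \<omega> \<and> X i \<omega> \<in> Q) *
        (ennreal (p * (1 - p) ^ card (\<Phi>l \<omega> \<inter> R)) * of_bool (\<Phi>e \<omega> \<inter> D = {}))"
    proof (cases "enat i < K \<omega> \<and> X i \<omega> \<in> Q \<and> \<Phi>e \<omega> \<inter> D = {}")
      case True
      \<comment> \<open>Disjointness of \<open>Q\<close> and \<open>R\<close> keeps label
        \<open>i\<close>, which has to transmit, out of the set of labels that have to be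
        silent.\<close>
      then have "i \<notin> J" using QR by (auto simp: J_def)
      have "(\<integral>\<^sup>+\<omega>'. of_bool (P (\<lambda>i. T i \<omega>', K \<omega>, \<lambda>i. X i \<omega>, \<Phi>e \<omega>)) \<partial>M)
          = (\<integral>\<^sup>+\<omega>'. indicator {\<omega>' \<in> space M. T i \<omega>' \<and> (\<forall>j\<in>J. \<not> T j \<omega>')} \<omega>' \<partial>M)"
        using True by (intro nn_integral_cong) (auto simp: P_def J_def indicator_def)
      also have "\<dots> = ennreal (prob {\<omega>' \<in> space M. T i \<omega>' \<and> (\<forall>j\<in>J. \<not> T j \<omega>')})"
        using \<open>finite J\<close> by (subst nn_integral_indicator) (auto simp: emeasure_eq_measure)
      also have "\<dots> = ennreal (p * (1 - p) ^ card J)"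
        using marks \<open>finite J\<close> \<open>i \<notin> J\<close> p
        by (subst prob_bernoulli_pattern[where p = p]) (auto simp: aloha_marks_def)
      finally show ?thesis using True J by simp
    next
      case False
      then have "\<not> P (\<lambda>i. T i \<omega>', K \<omega>, \<lambda>i. X i \<omega>, \<Phi>e \<omega>)" for \<omega>'
        using config_disjoint_iff[OF configurations_network(2)[OF \<omega>] D(2)] by (auto simp: P_def)
      then show ?thesis using False by auto
    qed
  qed
  finally show ?thesis .
qed

section \<open>Averaging over the positions of nodes and eavesdroppers\<close>

lemma poisson_count_l:
  assumes "B \<in> sets borel" "bounded B"
  shows "prob {\<omega> \<in> space M. card (\<Phi>l \<omega> \<inter> B) = n} =
    exp (- (lam_l * measure lborel B)) * (lam_l * measure lborel B) ^ n / fact n"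
  using poisson_l assms unfolding poisson_process_def by blast

lemma nn_integral_card:
  assumes "B \<in> sets borel" "bounded B"
  shows "(\<integral>\<^sup>+\<omega>. of_nat (card (\<Phi>l \<omega> \<inter> B)) \<partial>M) = ennreal (lam_l * measure lborel B)"
  unfolding ennreal_of_nat_eq_real_of_nat
  by (rule poisson_mean[OF measurable_card(1)[OF assms] poisson_count_l[OF assms]])

text \<open>Counts in the disjoint sets \<open>Q\<close> and \<open>R\<close> are independent, so
  the mean of the first multiplies the generating function of the second at
  \<open>1 - p\<close>.\<close>

lemma nn_integral_card_power:
  assumes Q: "Q \<in> sets borel" "bounded Q" and R: "R \<in> sets borel" "bounded R" and QR: "Q \<inter> R = {}"
  shows "(\<integral>\<^sup>+\<omega>. of_nat (card (\<Phi>l \<omega> \<inter> Q)) * ennreal ((1 - p) ^ card (\<Phi>l \<omega> \<inter> R)) \<partial>M)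
    = ennreal (lam_l * measure lborel Q * exp (- (p * lam_l * measure lborel R)))"
proof -
  define B where "B = (\<lambda>i::nat. if i = 0 then Q else R)"
  define g where "g = (\<lambda>i::nat. if i = 0 then of_nat else (\<lambda>n. ennreal ((1 - p) ^ n)))"
  have "indep_vars (\<lambda>_. count_space UNIV) (\<lambda>i \<omega>. card (\<Phi>l \<omega> \<inter> B i)) {..<2::nat}"
  proof -
    have "disjoint_family_on B {..<2}"
      using QR by (auto simp: disjoint_family_on_def B_def)
    moreover have "\<forall>i<2. B i \<in> sets borel \<and> bounded (B i)" using Q R by (auto simp: B_def)
    ultimately show ?thesis using poisson_l unfolding poisson_process_def by blast
  qed
  then have "indep_vars (\<lambda>_. borel) (\<lambda>i \<omega>. g i (card (\<Phi>l \<omega> \<inter> B i))) {..<2}"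
    by (rule indep_vars_compose2) auto
  then have "(\<integral>\<^sup>+\<omega>. (\<Prod>i<2. g i (card (\<Phi>l \<omega> \<inter> B i))) \<partial>M)
      = (\<Prod>i<2. \<integral>\<^sup>+\<omega>. g i (card (\<Phi>l \<omega> \<inter> B i)) \<partial>M)"
    by (intro indep_vars_nn_integral) auto
  then have "(\<integral>\<^sup>+\<omega>. of_nat (card (\<Phi>l \<omega> \<inter> Q)) * ennreal ((1 - p) ^ card (\<Phi>l \<omega> \<inter> R)) \<partial>M)
    = (\<integral>\<^sup>+\<omega>. of_nat (card (\<Phi>l \<omega> \<inter> Q)) \<partial>M) * (\<integral>\<^sup>+\<omega>. ennreal ((1 - p) ^ card (\<Phi>l \<omega> \<inter> R)) \<partial>M)"
    by (simp add: numeral_2_eq_2 g_def B_def)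
  also have "\<dots> = ennreal (lam_l * measure lborel Q) * ennreal (exp (- ((1 - (1 - p)) * (lam_l * measure lborel R))))"
    by (subst poisson_pgf[OF measurable_card(1)[OF R] poisson_count_l[OF R]])
      (use p in \<open>auto simp: nn_integral_card Q\<close>)
  also have "\<dots> = ennreal (lam_l * measure lborel Q * exp (- (p * lam_l * measure lborel R)))"
    using lam_l by (simp add: ennreal_mult mult.assoc)
  finally show ?thesis .
qed

text \<open>The value is the one for transmitters forming a Poisson process of density
  \<open>p * lam_l\<close>: a mean count in \<open>Q\<close> times the void probabilities of
  \<open>R\<close> and \<open>D\<close>. Counting the transmitters of \<open>Q\<close> label by
  label reduces it to the average over finitely many marks, without the law of
  \<open>\<Phi>t\<close> as a process.\<close>

lemma nn_integral_cell:
  assumes Q: "Q \<in> sets borel" "bounded Q" and R: "R \<in> sets borel" "bounded R"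
    and D: "D \<in> sets borel" "bounded D" and QR: "Q \<inter> R = {}"
  shows "(\<integral>\<^sup>+\<omega>. of_nat (card (\<Phi>t \<omega> \<inter> Q)) * of_bool (\<Phi>t \<omega> \<inter> R = {} \<and> \<Phi>e \<omega> \<inter> D = {}) \<partial>M)
    = ennreal (p * lam_l * measure lborel Q * exp (- (p * lam_l * measure lborel R)) *
        exp (- (lam_e * measure lborel D)))"
proof -
  note [measurable] = Q(1) R(1) measurable_card(1)[OF R] measurable_card(2)[OF D]
    measurable_card(1)[OF Q]
  have e: "\<Phi>e \<omega> \<inter> D = {} \<longleftrightarrow> card (\<Phi>e \<omega> \<inter> D) = 0" if "\<omega> \<in> space M" for \<omega>
    by (rule config_disjoint_iff[OF configurations_network(2)[OF that] D(2)])
  have [measurable]: "Measurable.pred M (\<lambda>\<omega>. \<Phi>e \<omega> \<inter> D = {})"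
    by (subst measurable_cong[OF e]) auto
  have "(\<integral>\<^sup>+\<omega>. of_nat (card (\<Phi>t \<omega> \<inter> Q)) * of_bool (\<Phi>t \<omega> \<inter> R = {} \<and> \<Phi>e \<omega> \<inter> D = {}) \<partial>M)
      = (\<integral>\<^sup>+\<omega>. (\<Sum>i. of_bool (enat i < K \<omega> \<and> X i \<omega> \<in> Q \<and> T i \<omega> \<and> \<Phi>t \<omega> \<inter> R = {} \<and> \<Phi>e \<omega> \<inter> D = {})) \<partial>M)"
  proof (rule nn_integral_cong)
    fix \<omega> assume \<omega>: "\<omega> \<in> space M"
    have "finite {i. enat i < K \<omega> \<and> X i \<omega> \<in> Q \<and> T i \<omega>}"
      by (rule finite_subset[OF _ finite_indices[OF \<omega> Q(2)]]) auto
    note * = suminf_of_bool[OF this]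
    show "of_nat (card (\<Phi>t \<omega> \<inter> Q)) * of_bool (\<Phi>t \<omega> \<inter> R = {} \<and> \<Phi>e \<omega> \<inter> D = {})
      = (\<Sum>i. of_bool (enat i < K \<omega> \<and> X i \<omega> \<in> Q \<and> T i \<omega> \<and> \<Phi>t \<omega> \<inter> R = {} \<and> \<Phi>e \<omega> \<inter> D = {}) :: ennreal)"
    proof (cases "\<Phi>t \<omega> \<inter> R = {} \<and> \<Phi>e \<omega> \<inter> D = {}")
      case True
      then show ?thesis using * by (simp add: card_indices_transmitters[OF \<omega> Q(2)])
    next
      case False
      then have "(enat i < K \<omega> \<and> X i \<omega> \<in> Q \<and> T i \<omega> \<and> \<Phi>t \<omega> \<inter> R = {} \<and> \<Phi>e \<omega> \<inter> D = {}) = False" for i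
        by auto
      with False show ?thesis by (simp only: of_bool_eq suminf_zero mult_zero_right)
    qed
  qed
  also have "\<dots> = (\<Sum>i. \<integral>\<^sup>+\<omega>. of_bool (enat i < K \<omega> \<and> X i \<omega> \<in> Q \<and> T i \<omega> \<and> \<Phi>t \<omega> \<inter> R = {} \<and> \<Phi>e \<omega> \<inter> D = {}) \<partial>M)"
    unfolding transmitters_disjoint_iff by (intro nn_integral_suminf measurable_of_bool) measurable
  also have "\<dots> = (\<Sum>i. \<integral>\<^sup>+\<omega>. of_bool (enat i < K \<omega> \<and> X i \<omega> \<in> Q) *
        (ennreal (p * (1 - p) ^ card (\<Phi>l \<omega> \<inter> R)) * of_bool (\<Phi>e \<omega> \<inter> D = {})) \<partial>M)"
    by (simp only: nn_integral_marks[OF Q(1) R D QR])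
  \<comment> \<open>With the marks averaged out, only positions remain under the sum, and summing
    over labels again yields the number of all legitimate nodes in \<open>Q\<close>.\<close>
  also have "\<dots> = (\<integral>\<^sup>+\<omega>. (\<Sum>i. of_bool (enat i < K \<omega> \<and> X i \<omega> \<in> Q) *
        (ennreal (p * (1 - p) ^ card (\<Phi>l \<omega> \<inter> R)) * of_bool (\<Phi>e \<omega> \<inter> D = {}))) \<partial>M)"
    by (intro nn_integral_suminf[symmetric] borel_measurable_times measurable_of_bool) measurable
  also have "\<dots> = (\<integral>\<^sup>+\<omega>. ennreal p * ((of_nat (card (\<Phi>l \<omega> \<inter> Q)) * ennreal ((1 - p) ^ card (\<Phi>l \<omega> \<inter> R)))
      * of_bool (card (\<Phi>e \<omega> \<inter> D) = 0)) \<partial>M)"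
  proof (rule nn_integral_cong)
    fix \<omega> assume \<omega>: "\<omega> \<in> space M"
    show "(\<Sum>i. of_bool (enat i < K \<omega> \<and> X i \<omega> \<in> Q) *
        (ennreal (p * (1 - p) ^ card (\<Phi>l \<omega> \<inter> R)) * of_bool (\<Phi>e \<omega> \<inter> D = {})))
      = ennreal p * ((of_nat (card (\<Phi>l \<omega> \<inter> Q)) * ennreal ((1 - p) ^ card (\<Phi>l \<omega> \<inter> R)))
      * of_bool (card (\<Phi>e \<omega> \<inter> D) = 0))"
      using p by (simp only: ennreal_suminf_multc suminf_of_bool[OF finite_indices[OF \<omega> Q(2)]]
        card_indices[OF \<omega> Q(2)] e[OF \<omega>]) (simp add: ennreal_mult mult_ac)
  qed
  also have "\<dots> = ennreal p * (\<integral>\<^sup>+\<omega>. (of_nat (card (\<Phi>l \<omega> \<inter> Q)) * ennreal ((1 - p) ^ card (\<Phi>l \<omega> \<inter> R)))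
      * of_bool (card (\<Phi>e \<omega> \<inter> D) = 0) \<partial>M)"
    by (intro nn_integral_cmult borel_measurable_times measurable_of_bool) measurable
  also have "(\<integral>\<^sup>+\<omega>. (of_nat (card (\<Phi>l \<omega> \<inter> Q)) * ennreal ((1 - p) ^ card (\<Phi>l \<omega> \<inter> R)))
      * of_bool (card (\<Phi>e \<omega> \<inter> D) = 0) \<partial>M)
    = (\<integral>\<^sup>+\<omega>. of_nat (card (\<Phi>l \<omega> \<inter> Q)) * ennreal ((1 - p) ^ card (\<Phi>l \<omega> \<inter> R)) \<partial>M) *
      (\<integral>\<^sup>+\<omega>. of_bool (card (\<Phi>e \<omega> \<inter> D) = 0) \<partial>M)"
  proof (rule indep_var_nn_integral_mult)
    note [measurable] = measurable_card_Int[OF Q] measurable_card_Int[OF R] measurable_card_Int[OF D]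
    have "indep_var borel ((\<lambda>A. of_nat (card (A \<inter> Q)) * ennreal ((1 - p) ^ card (A \<inter> R))) \<circ> \<Phi>l)
        borel ((\<lambda>A. of_bool (card (A \<inter> D) = 0) :: ennreal) \<circ> \<Phi>e)"
      by (intro indep_var_compose[OF indep] measurable_of_bool) measurable
    then show "indep_var borel (\<lambda>\<omega>. of_nat (card (\<Phi>l \<omega> \<inter> Q)) * ennreal ((1 - p) ^ card (\<Phi>l \<omega> \<inter> R)))
        borel (\<lambda>\<omega>. of_bool (card (\<Phi>e \<omega> \<inter> D) = 0) :: ennreal)"
      by (simp add: comp_def)
  qed
  also have "(\<integral>\<^sup>+\<omega>. of_bool (card (\<Phi>e \<omega> \<inter> D) = 0) \<partial>M) = ennreal (exp (- (lam_e * measure lborel D)))"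
  proof -
    have "(\<integral>\<^sup>+\<omega>. of_bool (card (\<Phi>e \<omega> \<inter> D) = 0) \<partial>M)
        = (\<integral>\<^sup>+\<omega>. indicator {\<omega> \<in> space M. card (\<Phi>e \<omega> \<inter> D) = 0} \<omega> \<partial>M)"
      by (intro nn_integral_cong) (auto simp: indicator_def)
    also have "\<dots> = ennreal (prob {\<omega> \<in> space M. card (\<Phi>e \<omega> \<inter> D) = 0})"
      by (subst nn_integral_indicator) (auto simp: emeasure_eq_measure)
    also have "prob {\<omega> \<in> space M. card (\<Phi>e \<omega> \<inter> D) = 0} = exp (- (lam_e * measure lborel D))"
      using poisson_e D unfolding poisson_process_def by simp
    finally show ?thesis .
  qed
  finally show ?thesis
    using p lam_l by (simp add: nn_integral_card_power[OF Q R QR] ennreal_mult mult_ac)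
qed

text \<open>Measurability is read off from the series over labels. The series is taken in
  \<open>ennreal\<close>, where it always converges, and is then mapped back to the reals.\<close>

lemma measurable_transmitter_count:
  assumes "B \<in> sets borel" "bounded B"
  shows "(\<lambda>\<omega>. real (card (\<Phi>t \<omega> \<inter> B))) \<in> borel_measurable M"
proof -
  note [measurable] = assms(1)
  have "real (card (\<Phi>t \<omega> \<inter> B)) = enn2real (\<Sum>i. of_bool (enat i < K \<omega> \<and> X i \<omega> \<in> B \<and> T i \<omega>))"
    if \<omega>: "\<omega> \<in> space M" for \<omega>
  proof -
    have "finite {i. enat i < K \<omega> \<and> X i \<omega> \<in> B \<and> T i \<omega>}"
      by (rule finite_subset[OF _ finite_indices[OF \<omega> assms(2)]]) auto
    then show ?thesis
      by (simp add: suminf_of_bool card_indices_transmitters[OF \<omega> assms(2)])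
  qed
  moreover have "(\<lambda>\<omega>. enn2real (\<Sum>i. of_bool (enat i < K \<omega> \<and> X i \<omega> \<in> B \<and> T i \<omega>))) \<in> borel_measurable M"
    by (intro measurable_compose[OF _ borel_measurable_enn2real] borel_measurable_suminf measurable_of_bool)
      measurable
  ultimately show ?thesis by (subst measurable_cong)
qed

lemma has_bochner_integral_cell:
  assumes Q: "Q \<in> sets borel" "bounded Q" and R: "R \<in> sets borel" "bounded R"
    and D: "D \<in> sets borel" "bounded D" and QR: "Q \<inter> R = {}"
  shows "has_bochner_integral M
    (\<lambda>\<omega>. real (card (\<Phi>t \<omega> \<inter> Q)) * of_bool (\<Phi>t \<omega> \<inter> R = {} \<and> \<Phi>e \<omega> \<inter> D = {}))
    (p * lam_l * measure lborel Q * exp (- (p * lam_l * measure lborel R)) *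
        exp (- (lam_e * measure lborel D)))"
proof (rule has_bochner_integral_nn_integral)
  note [measurable] = R(1) measurable_transmitter_count[OF Q] measurable_card(2)[OF D]
  have e: "\<Phi>e \<omega> \<inter> D = {} \<longleftrightarrow> card (\<Phi>e \<omega> \<inter> D) = 0" if "\<omega> \<in> space M" for \<omega>
    by (rule config_disjoint_iff[OF configurations_network(2)[OF that] D(2)])
  have [measurable]: "Measurable.pred M (\<lambda>\<omega>. \<Phi>e \<omega> \<inter> D = {})"
    by (subst measurable_cong[OF e]) auto
  show "(\<lambda>\<omega>. real (card (\<Phi>t \<omega> \<inter> Q)) * of_bool (\<Phi>t \<omega> \<inter> R = {} \<and> \<Phi>e \<omega> \<inter> D = {})) \<in> borel_measurable M"
    unfolding transmitters_disjoint_iff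
    by (intro borel_measurable_times measurable_of_bool) measurable
  have "(\<integral>\<^sup>+\<omega>. ennreal (real (card (\<Phi>t \<omega> \<inter> Q)) * of_bool (\<Phi>t \<omega> \<inter> R = {} \<and> \<Phi>e \<omega> \<inter> D = {})) \<partial>M)
    = (\<integral>\<^sup>+\<omega>. of_nat (card (\<Phi>t \<omega> \<inter> Q)) * of_bool (\<Phi>t \<omega> \<inter> R = {} \<and> \<Phi>e \<omega> \<inter> D = {}) \<partial>M)"
    by (intro nn_integral_cong) (auto simp: ennreal_of_nat_eq_real_of_nat)
  then show "(\<integral>\<^sup>+\<omega>. ennreal (real (card (\<Phi>t \<omega> \<inter> Q)) * of_bool (\<Phi>t \<omega> \<inter> R = {} \<and> \<Phi>e \<omega> \<inter> D = {})) \<partial>M)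
    = ennreal (p * lam_l * measure lborel Q * exp (- (p * lam_l * measure lborel R)) *
        exp (- (lam_e * measure lborel D)))"
    using nn_integral_cell[OF assms] by simp
qed (simp_all add: p lam_l)

end

section \<open>Discretisation\<close>

text \<open>Each coordinate is rounded down to a multiple of \<open>1 / (real n + 1)\<close>. The
  error is at most one such step per coordinate, whence the mesh
  \<open>real DIM('b) / (real n + 1)\<close>.\<close>

lemma ex_grid:
  "\<exists>(g :: nat \<Rightarrow> 'b::euclidean_space \<Rightarrow> 'b) \<delta>. (\<forall>n. g n \<in> borel_measurable borel) \<and>
    (\<forall>n r. finite (g n ` ball 0 r)) \<and> (\<forall>n y. dist (g n y) y \<le> \<delta> n) \<and> \<delta> \<longlonglongrightarrow> 0"
proof (intro exI conjI allI)
  let ?f = "\<lambda>n (y::'b) b. \<lfloor>(real n + 1) * (y \<bullet> b)\<rfloor>"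
  let ?h = "\<lambda>n F. \<Sum>b\<in>Basis. (real_of_int (F b) / (real n + 1)) *\<^sub>R (b::'b)"
  let ?g = "\<lambda>n y. ?h n (?f n y)"
  show "?g n \<in> borel_measurable borel" for n
    by measurable
  show "finite (?g n ` ball 0 r)" for n r
  proof (rule finite_subset)
    let ?m = "\<lceil>(real n + 1) * \<bar>r\<bar>\<rceil> + 1"
    \<comment> \<open>A grid point is determined by its integer coordinates on \<open>Basis\<close>;
      for points of the ball these are bounded, and the extensional functions with bounded integer
      values form a finite set.\<close>
    show "?g n ` ball 0 r \<subseteq> ?h n ` (Basis \<rightarrow>\<^sub>E {- ?m..?m})"
    proof (rule image_subsetI)
      fix y :: 'b assume y: "y \<in> ball 0 r"
      have "?f n y b \<in> {- ?m..?m}" if b: "b \<in> Basis" for b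
      proof -
        have "\<bar>y \<bullet> b\<bar> \<le> \<bar>r\<bar>" using Basis_le_norm[OF b, of y] y by auto
        then have "\<bar>(real n + 1) * (y \<bullet> b)\<bar> \<le> (real n + 1) * \<bar>r\<bar>"
          by (simp add: abs_mult mult_left_mono)
        then show ?thesis unfolding atLeastAtMost_iff by linarith
      qed
      then have "restrict (?f n y) Basis \<in> Basis \<rightarrow>\<^sub>E {- ?m..?m}" by auto
      moreover have "?g n y = ?h n (restrict (?f n y) Basis)" by simp
      ultimately show "?g n y \<in> ?h n ` (Basis \<rightarrow>\<^sub>E {- ?m..?m})" by blast
    qed
  qed (intro finite_imageI finite_PiE; simp)
  show "dist (?g n y) y \<le> real DIM('b) / (real n + 1)" for n y
  proof -
    have "?g n y - y = (\<Sum>b\<in>Basis. (real_of_int (?f n y b) / (real n + 1) - y \<bullet> b) *\<^sub>R b)"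
      by (subst (4) euclidean_representation[symmetric]) (simp add: scaleR_left_diff_distrib sum_subtractf)
    also have "norm \<dots> \<le> (\<Sum>b\<in>(Basis :: 'b set). 1 / (real n + 1))"
    proof (rule sum_norm_le)
      fix b :: 'b assume b: "b \<in> Basis"
      have "real_of_int (?f n y b) / (real n + 1) - y \<bullet> b
          = (real_of_int (?f n y b) - (real n + 1) * (y \<bullet> b)) / (real n + 1)"
        by (simp add: field_simps)
      moreover have "\<bar>real_of_int (?f n y b) - (real n + 1) * (y \<bullet> b)\<bar> \<le> 1" by linarith
      ultimately show "norm ((real_of_int (?f n y b) / (real n + 1) - y \<bullet> b) *\<^sub>R b) \<le> 1 / (real n + 1)"
        using b by (simp add: divide_right_mono)
    qed
    finally show ?thesis by (simp add: dist_norm)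
  qed
  have "(\<lambda>n. real DIM('b) * inverse (real (Suc n))) \<longlonglongrightarrow> real DIM('b) * 0"
    by (intro tendsto_mult tendsto_const LIMSEQ_inverse_real_of_nat)
  then show "(\<lambda>n. real DIM('b) / (real n + 1)) \<longlonglongrightarrow> 0"
    by (simp add: divide_inverse add.commute)
qed

text \<open>Terms outside the disk of radius \<eta> vanish by the range condition, and local
  finiteness leaves a finite sum.\<close>

lemma secure_in_degree_eq_sum:
  assumes "A \<in> configurations"
  shows "secure_in_degree \<eta> \<beta>l \<beta>e A E 0 = (\<Sum>y\<in>A \<inter> ball 0 \<eta>.
    of_bool ((\<forall>z\<in>A. z \<noteq> y \<longrightarrow> z \<notin> ball 0 (\<beta>l * norm y)) \<and> E \<inter> ball y (\<beta>e * norm y) = {}))"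
    (is "_ = sum ?c _")
proof -
  have "secure_in_degree \<eta> \<beta>l \<beta>e A E 0 = infsum ?c (A \<inter> ball 0 \<eta>)"
    unfolding secure_in_degree_def
    by (rule infsum_cong_neutral) (auto simp: single_hop_def)
  then show ?thesis
    using finite_configuration_Int[OF assms] by simp
qed

text \<open>The \<open>max\<close> covers the negative radii that shrinking can produce, and makes
  the volume a continuous function of the radius.\<close>

lemma measure_lborel_ball:
  "measure lborel (ball (c::'b::euclidean_space) r) = unit_ball_vol (real DIM('b)) * max 0 r ^ DIM('b)"
  by (cases "r \<ge> 0") (simp_all add: content_ball ball_empty)

text \<open>The radii are shrunk by the mesh width, so that the approximating disks lie inside the true
  ones. As these are open, the approximation converges for every configuration, without
  exceptional null sets.\<close>

locale grid_approximation =
  fixes g :: "nat \<Rightarrow> 'b::euclidean_space \<Rightarrow> 'b" and \<delta> :: "nat \<Rightarrow> real" and \<eta> \<beta>l \<beta>e :: real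
  assumes measurable_grid [measurable]: "\<And>n. g n \<in> borel_measurable borel"
    and finite_grid: "\<And>n. finite (g n ` ball 0 \<eta>)"
    and dist_grid: "\<And>n y. dist (g n y) y \<le> \<delta> n"
    and mesh_0: "\<delta> \<longlonglongrightarrow> 0"
    and \<beta>: "0 < \<beta>l" "0 < \<beta>e"
begin

definition cell :: "nat \<Rightarrow> 'b \<Rightarrow> 'b set" where
  "cell n k = {y \<in> ball 0 \<eta>. g n y = k}"

definition near :: "nat \<Rightarrow> 'b \<Rightarrow> 'b set" where
  "near n k = ball 0 (\<beta>l * (norm k - \<delta> n))"

text \<open>Of the reduction \<open>(1 + \<beta>e) * \<delta> n\<close>, one \<delta> pays for
  moving the centre from \<open>k\<close> to a point \<open>y\<close> of the cell, and
  \<open>\<beta>e * \<delta> n\<close> for replacing \<open>norm k\<close> by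
  \<open>norm y\<close>.\<close>

definition exposed :: "nat \<Rightarrow> 'b \<Rightarrow> 'b set" where
  "exposed n k = ball k (\<beta>e * norm k - (1 + \<beta>e) * \<delta> n)"

text \<open>The cell is removed from \<open>near\<close> because a transmitter does not block
  itself. This also makes the counted set and the void set disjoint, as the expectation for one cell
  demands; that transmitters sharing a cell no longer block each other is an error that vanishes in
  the limit.\<close>

definition approx_degree :: "nat \<Rightarrow> 'b set \<Rightarrow> 'b set \<Rightarrow> real" where
  "approx_degree n A E = (\<Sum>k\<in>g n ` ball 0 \<eta>.
     real (card (A \<inter> cell n k)) * of_bool (A \<inter> (near n k - cell n k) = {} \<and> E \<inter> exposed n k = {}))"

lemma cell_sets: "cell n k \<in> sets borel" "bounded (cell n k)"
proof -
  show "cell n k \<in> sets borel" unfolding cell_def by measurable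
  show "bounded (cell n k)" by (rule bounded_subset[of "ball 0 \<eta>"]) (auto simp: cell_def)
qed

lemma near_sets: "near n k - cell n k \<in> sets borel" "bounded (near n k - cell n k)"
  using cell_sets(1)[of n k] by (auto simp: near_def intro: bounded_subset[OF bounded_ball])

lemma exposed_sets: "exposed n k \<in> sets borel" "bounded (exposed n k)"
  by (auto simp: exposed_def)

lemma tendsto_grid: "(\<lambda>n. g n y) \<longlonglongrightarrow> y"
  by (rule metric_tendsto_imp_tendsto[OF mesh_0])
    (use dist_grid in \<open>auto simp: dist_real_def intro!: always_eventually order_trans[OF dist_grid]\<close>)

lemma norm_grid: "norm (g n y) \<le> norm y + \<delta> n"
  using dist_grid[of n y] norm_triangle_sub[of "g n y" y] by (simp add: dist_norm)

lemma near_subset: "near n (g n y) \<subseteq> ball 0 (\<beta>l * norm y)"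
proof -
  have "\<beta>l * (norm (g n y) - \<delta> n) \<le> \<beta>l * norm y"
    using norm_grid[of n y] \<beta> by (intro mult_left_mono) auto
  then show ?thesis unfolding near_def by (rule subset_ball)
qed

lemma exposed_subset: "exposed n (g n y) \<subseteq> ball y (\<beta>e * norm y)"
proof
  fix z assume "z \<in> exposed n (g n y)"
  then have "dist (g n y) z < \<beta>e * norm (g n y) - (1 + \<beta>e) * \<delta> n" by (simp add: exposed_def)
  moreover have "\<beta>e * norm (g n y) \<le> \<beta>e * (norm y + \<delta> n)"
    using norm_grid \<beta> by (intro mult_left_mono) auto
  moreover have "dist y z \<le> dist (g n y) y + dist (g n y) z"
    by (rule dist_triangle3)
  ultimately show "z \<in> ball y (\<beta>e * norm y)"
    using dist_grid[of n y] by (simp add: algebra_simps)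
qed

lemma tendsto_near_radius: "(\<lambda>n. \<beta>l * (norm (g n y) - \<delta> n)) \<longlonglongrightarrow> \<beta>l * norm y"
  by (rule tendsto_eq_intros tendsto_grid mesh_0 | simp)+

lemma tendsto_exposed_radius: "(\<lambda>n. \<beta>e * norm (g n y) - (1 + \<beta>e) * \<delta> n) \<longlonglongrightarrow> \<beta>e * norm y"
  by (rule tendsto_eq_intros tendsto_grid mesh_0 | simp)+

lemma eventually_near:
  assumes "z \<in> ball 0 (\<beta>l * norm y)"
  shows "\<forall>\<^sub>F n in sequentially. z \<in> near n (g n y)"
  using order_tendstoD(1)[OF tendsto_near_radius, of "norm z" y] assms by (simp add: near_def)

lemma eventually_exposed:
  assumes "z \<in> ball y (\<beta>e * norm y)"
  shows "\<forall>\<^sub>F n in sequentially. z \<in> exposed n (g n y)"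
proof -
  have "(\<lambda>n. \<beta>e * norm (g n y) - (1 + \<beta>e) * \<delta> n - dist (g n y) z) \<longlonglongrightarrow> \<beta>e * norm y - dist y z"
    by (intro tendsto_diff tendsto_exposed_radius tendsto_dist tendsto_grid tendsto_const)
  from order_tendstoD(1)[OF this, of 0] show ?thesis
    using assms by (simp add: exposed_def)
qed

section \<open>Pointwise convergence of the discretised degree\<close>

lemma eventually_near_iff:
  assumes y: "y \<in> ball 0 \<eta>"
  shows "\<forall>\<^sub>F n in sequentially. A \<inter> (near n (g n y) - cell n (g n y)) = {} \<longleftrightarrow>
    (\<forall>z\<in>A. z \<noteq> y \<longrightarrow> z \<notin> ball 0 (\<beta>l * norm y))"
proof (cases "\<forall>z\<in>A. z \<noteq> y \<longrightarrow> z \<notin> ball 0 (\<beta>l * norm y)")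
  case True
  have "A \<inter> (near n (g n y) - cell n (g n y)) = {}" for n
  proof -
    have "y \<in> cell n (g n y)" using y by (simp add: cell_def)
    then have "z \<noteq> y" if "z \<notin> cell n (g n y)" for z using that by auto
    then show ?thesis using near_subset[of n y] True by blast
  qed
  with True show ?thesis by simp
next
  case False
  then obtain z where z: "z \<in> A" "z \<noteq> y" "z \<in> ball 0 (\<beta>l * norm y)" by blast
  \<comment> \<open>The grid values of \<open>z\<close> and \<open>y\<close> have different limits,
    so a blocking node \<open>z\<close> eventually leaves the cell of \<open>y\<close> and is then
    seen by the approximation.\<close>
  have "(\<lambda>n. dist (g n z) (g n y)) \<longlonglongrightarrow> dist z y"
    by (intro tendsto_dist tendsto_grid)
  then have "\<forall>\<^sub>F n in sequentially. 0 < dist (g n z) (g n y)"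
    by (rule order_tendstoD) (use z in simp)
  with eventually_near[OF z(3)] show ?thesis
  proof eventually_elim
    case (elim n)
    then have "z \<in> A \<inter> (near n (g n y) - cell n (g n y))"
      using z by (auto simp: cell_def)
    with False show ?case by blast
  qed
qed

lemma eventually_exposed_iff:
  "\<forall>\<^sub>F n in sequentially. E \<inter> exposed n (g n y) = {} \<longleftrightarrow> E \<inter> ball y (\<beta>e * norm y) = {}"
proof (cases "E \<inter> ball y (\<beta>e * norm y) = {}")
  case True
  then have "E \<inter> exposed n (g n y) = {}" for n
    using exposed_subset[of n y] by blast
  with True show ?thesis by simp
next
  case False
  then obtain z where z: "z \<in> E" "z \<in> ball y (\<beta>e * norm y)" by blast
  from eventually_exposed[OF z(2)] show ?thesis
    by eventually_elim (use z False in blast)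
qed

text \<open>Grouping points by their grid value turns the sum over cells into a sum over
  \<open>A \<inter> ball 0 \<eta>\<close>, the index set of the true degree, so that the two can be
  compared term by term.\<close>

lemma approx_degree_eq:
  assumes "A \<in> configurations"
  shows "approx_degree n A E = (\<Sum>y\<in>A \<inter> ball 0 \<eta>.
    of_bool (A \<inter> (near n (g n y) - cell n (g n y)) = {} \<and> E \<inter> exposed n (g n y) = {}))"
    (is "_ = (\<Sum>y\<in>_. ?c (g n y))")
proof -
  have "real (card (A \<inter> cell n k)) * ?c k = (\<Sum>y\<in>{y \<in> A \<inter> ball 0 \<eta>. g n y = k}. ?c (g n y))" for k
  proof -
    have "A \<inter> cell n k = {y \<in> A \<inter> ball 0 \<eta>. g n y = k}" by (auto simp: cell_def)
    then have "real (card (A \<inter> cell n k)) * ?c k = (\<Sum>y\<in>{y \<in> A \<inter> ball 0 \<eta>. g n y = k}. ?c k)"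
      by simp
    also have "\<dots> = (\<Sum>y\<in>{y \<in> A \<inter> ball 0 \<eta>. g n y = k}. ?c (g n y))"
      by (rule sum.cong) auto
    finally show ?thesis .
  qed
  then have "approx_degree n A E
      = (\<Sum>k\<in>g n ` ball 0 \<eta>. \<Sum>y\<in>{y \<in> A \<inter> ball 0 \<eta>. g n y = k}. ?c (g n y))"
    by (simp only: approx_degree_def)
  also have "\<dots> = (\<Sum>y\<in>A \<inter> ball 0 \<eta>. ?c (g n y))"
    by (rule sum.group) (auto intro: finite_configuration_Int[OF assms] finite_grid)
  finally show ?thesis .
qed

lemma approx_degree_bounds:
  assumes "A \<in> configurations"
  shows "0 \<le> approx_degree n A E" "approx_degree n A E \<le> real (card (A \<inter> ball 0 \<eta>))"
proof -
  show "0 \<le> approx_degree n A E" by (simp add: approx_degree_eq[OF assms] sum_nonneg)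
  have "approx_degree n A E \<le> (\<Sum>y\<in>A \<inter> ball 0 \<eta>. 1)"
    unfolding approx_degree_eq[OF assms] by (intro sum_mono) simp
  then show "approx_degree n A E \<le> real (card (A \<inter> ball 0 \<eta>))" by simp
qed

text \<open>The index set is finite and independent of \<open>n\<close>, and each 0-1 term
  eventually equals its limit.\<close>

lemma approx_degree_tendsto:
  assumes "A \<in> configurations"
  shows "(\<lambda>n. approx_degree n A E) \<longlonglongrightarrow> secure_in_degree \<eta> \<beta>l \<beta>e A E 0"
  unfolding approx_degree_eq[OF assms] secure_in_degree_eq_sum[OF assms]
proof (intro tendsto_sum tendsto_eventually)
  fix y assume "y \<in> A \<inter> ball 0 \<eta>"
  then have "y \<in> ball 0 \<eta>" by simp
  from eventually_near_iff[OF this, of A] eventually_exposed_iff[of E y]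
  show "\<forall>\<^sub>F n in sequentially.
      of_bool (A \<inter> (near n (g n y) - cell n (g n y)) = {} \<and> E \<inter> exposed n (g n y) = {})
      = (of_bool ((\<forall>z\<in>A. z \<noteq> y \<longrightarrow> z \<notin> ball 0 (\<beta>l * norm y)) \<and> E \<inter> ball y (\<beta>e * norm y) = {}) :: real)"
    by eventually_elim simp
qed

section \<open>Sums over cells as Lebesgue integrals\<close>

lemma step_function_eq:
  fixes w :: "'b \<Rightarrow> real"
  shows "indicator (ball 0 \<eta>) y * w (g n y) = (\<Sum>k\<in>g n ` ball 0 \<eta>. w k * indicator (cell n k) y)"
proof (cases "y \<in> ball 0 \<eta>")
  case True
  then have "w k * indicator (cell n k) y = (if g n y = k then w k else 0)" for k
    by (simp add: cell_def)
  then show ?thesis using True finite_grid by (simp del: mem_ball)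
qed (simp add: cell_def)

lemma sum_cells_eq_integral:
  fixes w :: "'b \<Rightarrow> real"
  shows "(\<Sum>k\<in>g n ` ball 0 \<eta>. w k * measure lborel (cell n k))
    = (\<integral>y. indicator (ball 0 \<eta>) y * w (g n y) \<partial>lborel)"
proof -
  have int: "integrable lborel (\<lambda>y. w k * indicator (cell n k) y)" for k
    using cell_sets(1)[of n k] emeasure_bounded_finite[OF cell_sets(2), of n k]
    by (intro integrable_mult_right integrable_real_indicator) simp_all
  have "(\<integral>y. indicator (ball 0 \<eta>) y * w (g n y) \<partial>lborel)
      = (\<Sum>k\<in>g n ` ball 0 \<eta>. \<integral>y. w k * indicator (cell n k) y \<partial>lborel)"
    unfolding step_function_eq by (intro Bochner_Integration.integral_sum int)
  then show ?thesis using cell_sets(1) by simp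
qed

text \<open>Measurability comes from the finitely many measurable cells, with \<open>w\<close>
  arbitrary.\<close>

lemma measurable_step_function:
  fixes w :: "'b \<Rightarrow> real"
  shows "(\<lambda>y. indicator (ball 0 \<eta>) y * w (g n y)) \<in> borel_measurable lborel"
proof -
  note [measurable] = cell_sets(1)
  show ?thesis unfolding step_function_eq by measurable
qed

lemma tendsto_measure_exposed:
  "(\<lambda>n. measure lborel (exposed n (g n y))) \<longlonglongrightarrow> measure lborel (ball y (\<beta>e * norm y))"
  unfolding exposed_def measure_lborel_ball
  by (intro tendsto_intros tendsto_exposed_radius)

text \<open>Removing the cell changes nothing in the limit: the cell lies in a ball about its grid
  point whose radius tends to 0. The measure is squeezed between those of \<open>near\<close> with
  and without this ball's measure subtracted.\<close>

lemma tendsto_measure_near: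
  "(\<lambda>n. measure lborel (near n (g n y) - cell n (g n y))) \<longlonglongrightarrow> measure lborel (ball (0::'b) (\<beta>l * norm y))"
proof -
  have near: "(\<lambda>n. measure lborel (near n (g n y))) \<longlonglongrightarrow> measure lborel (ball (0::'b) (\<beta>l * norm y))"
    unfolding near_def measure_lborel_ball by (intro tendsto_intros tendsto_near_radius)
  \<comment> \<open>The extra \<open>1 / real (Suc n)\<close> lets the open ball contain the points
    at distance exactly \<open>\<delta> n\<close>.\<close>
  have "(\<lambda>n. measure lborel (ball (g n y) (\<delta> n + 1 / real (Suc n)))) \<longlonglongrightarrow>
      unit_ball_vol (real DIM('b)) * max 0 (0 + 0) ^ DIM('b)"
    unfolding measure_lborel_ball using LIMSEQ_inverse_real_of_nat
    by (intro tendsto_intros mesh_0) (simp add: divide_inverse)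
  then have "(\<lambda>n. measure lborel (ball (g n y) (\<delta> n + 1 / real (Suc n)))) \<longlonglongrightarrow> 0"
    by (simp add: zero_power del: of_nat_Suc)
  from tendsto_diff[OF near this]
  have lower: "(\<lambda>n. measure lborel (near n (g n y)) - measure lborel (ball (g n y) (\<delta> n + 1 / real (Suc n))))
    \<longlonglongrightarrow> measure lborel (ball (0::'b) (\<beta>l * norm y))" by simp
  have fm: "S \<in> fmeasurable lborel" if "S \<in> sets borel" "bounded S" for S :: "'b set"
    using that emeasure_bounded_finite[of S] by (intro fmeasurableI) simp_all
  have m: "near n k \<in> fmeasurable lborel" "cell n k \<in> fmeasurable lborel"
    "near n k - cell n k \<in> fmeasurable lborel" for n k
    using cell_sets[of n k] near_sets[of n k] by (simp_all add: fm near_def)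
  have upper_le: "\<forall>\<^sub>F n in sequentially. measure lborel (near n (g n y) - cell n (g n y)) \<le> measure lborel (near n (g n y))"
    by (intro always_eventually allI measure_mono_fmeasurable fmeasurableD m Diff_subset)
  have lower_le: "\<forall>\<^sub>F n in sequentially.
      measure lborel (near n (g n y)) - measure lborel (ball (g n y) (\<delta> n + 1 / real (Suc n)))
      \<le> measure lborel (near n (g n y) - cell n (g n y))"
  proof (intro always_eventually allI)
    fix n
    let ?B = "ball (g n y) (\<delta> n + 1 / real (Suc n))"
    have sub: "cell n (g n y) \<subseteq> ?B"
    proof
      fix z assume "z \<in> cell n (g n y)"
      then have "dist (g n y) z \<le> \<delta> n" using dist_grid[of n z] by (simp add: cell_def)
      moreover have "0 < 1 / real (Suc n)" by simp
      ultimately show "z \<in> ?B" unfolding mem_ball by linarith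
    qed
    have "measure lborel (near n (g n y)) \<le> measure lborel (cell n (g n y) \<union> (near n (g n y) - cell n (g n y)))"
      by (rule measure_mono_fmeasurable[OF _ fmeasurableD[OF m(1)] fmeasurable.Un[OF m(2,3)]]) blast
    also have "\<dots> \<le> measure lborel (cell n (g n y)) + measure lborel (near n (g n y) - cell n (g n y))"
      by (intro measure_Un_le fmeasurableD m)
    also have "measure lborel (cell n (g n y)) \<le> measure lborel ?B"
      by (rule measure_mono_fmeasurable[OF sub fmeasurableD[OF m(2)] fm]) simp_all
    finally show "measure lborel (near n (g n y)) - measure lborel ?B
        \<le> measure lborel (near n (g n y) - cell n (g n y))" by simp
  qed
  show ?thesis by (rule tendsto_sandwich[OF lower_le upper_le lower near])
qed

end

section \<open>Passage to the limit\<close>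

lemma (in aloha_network) has_bochner_integral_secure_in_degree:
  assumes pos: "0 < \<beta>l" "0 < \<beta>e" and lam_e: "0 \<le> lam_e"
  shows "has_bochner_integral M (\<lambda>\<omega>. secure_in_degree \<eta> \<beta>l \<beta>e (\<Phi>t \<omega>) (\<Phi>e \<omega>) 0)
    (\<integral>y. indicator (ball (0::'b) \<eta>) y * (p * lam_l *
      exp (- (p * lam_l * measure lborel (ball (0::'b) (\<beta>l * norm y)))) *
      exp (- (lam_e * measure lborel (ball y (\<beta>e * norm y))))) \<partial>lborel)"
proof -
  obtain g :: "nat \<Rightarrow> 'b \<Rightarrow> 'b" and \<delta> where "\<And>n. g n \<in> borel_measurable borel"
    "\<And>n r. finite (g n ` ball 0 r)" "\<And>n y. dist (g n y) y \<le> \<delta> n" "\<delta> \<longlonglongrightarrow> 0"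
    using ex_grid[where 'b='b] by blast
  then interpret grid_approximation g \<delta> \<eta> \<beta>l \<beta>e
    by unfold_locales (use pos in auto)
  \<comment> \<open>\<open>w n k\<close> is the expected contribution of cell \<open>k\<close> per
    unit of its volume: the transmitter density times the two void probabilities.\<close>
  define w where "w n k = p * lam_l * exp (- (p * lam_l * measure lborel (near n k - cell n k))) *
    exp (- (lam_e * measure lborel (exposed n k)))" for n k
  let ?D = "\<lambda>n \<omega>. approx_degree n (\<Phi>t \<omega>) (\<Phi>e \<omega>)"
  let ?N = "\<lambda>\<omega>. secure_in_degree \<eta> \<beta>l \<beta>e (\<Phi>t \<omega>) (\<Phi>e \<omega>) 0"
  have approx: "has_bochner_integral M (?D n) (\<integral>y. indicator (ball 0 \<eta>) y * w n (g n y) \<partial>lborel)" for n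
  proof -
    have "has_bochner_integral M (?D n) (\<Sum>k\<in>g n ` ball 0 \<eta>. w n k * measure lborel (cell n k))"
      unfolding approx_degree_def
    proof (rule has_bochner_integral_sum)
      fix k
      show "has_bochner_integral M (\<lambda>\<omega>. real (card (\<Phi>t \<omega> \<inter> cell n k)) *
          of_bool (\<Phi>t \<omega> \<inter> (near n k - cell n k) = {} \<and> \<Phi>e \<omega> \<inter> exposed n k = {}))
          (w n k * measure lborel (cell n k))"
        using has_bochner_integral_cell[OF cell_sets near_sets exposed_sets, of n k n k n k]
        by (simp add: w_def mult_ac Int_Diff)
    qed
    then show ?thesis by (simp only: sum_cells_eq_integral)
  qed
  \<comment> \<open>The number of legitimate nodes in the disk dominates all discretised degrees,
    and its mean is finite.\<close>
  have dom: "integrable M (\<lambda>\<omega>. real (card (\<Phi>l \<omega> \<inter> ball 0 \<eta>)))"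
  proof (rule integrableI_nonneg)
    show "(\<lambda>\<omega>. real (card (\<Phi>l \<omega> \<inter> ball 0 \<eta>))) \<in> borel_measurable M"
      by (rule measurable_compose[OF measurable_card(1)]) auto
    show "(\<integral>\<^sup>+\<omega>. ennreal (real (card (\<Phi>l \<omega> \<inter> ball 0 \<eta>))) \<partial>M) < \<infinity>"
      using nn_integral_card[of "ball 0 \<eta>"] by (simp add: ennreal_of_nat_eq_real_of_nat)
  qed simp
  have lim: "(\<lambda>n. ?D n \<omega>) \<longlonglongrightarrow> ?N \<omega>" if "\<omega> \<in> space M" for \<omega>
    by (rule approx_degree_tendsto[OF transmitters_configuration[OF that]])
  have D: "?D n \<in> borel_measurable M" for n
    using approx[of n] by (auto simp: has_bochner_integral_iff)
  \<comment> \<open>Measurability of the secure in-degree itself is obtained from its being a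
    pointwise limit.\<close>
  have N: "?N \<in> borel_measurable M"
    by (rule borel_measurable_LIMSEQ_real[OF lim D])
  have bound: "norm (?D n \<omega>) \<le> real (card (\<Phi>l \<omega> \<inter> ball 0 \<eta>))" if \<omega>: "\<omega> \<in> space M" for n \<omega>
  proof -
    have "card (\<Phi>t \<omega> \<inter> ball 0 \<eta>) \<le> card (\<Phi>l \<omega> \<inter> ball 0 \<eta>)"
      using transmitters_subset[OF \<omega>] configurations_network(1)[OF \<omega>]
      by (intro card_mono finite_configuration_Int) auto
    then show ?thesis
      using approx_degree_bounds[OF transmitters_configuration[OF \<omega>], of n "\<Phi>e \<omega>"] by simp
  qed
  have AE: "AE \<omega> in M. (\<lambda>n. ?D n \<omega>) \<longlonglongrightarrow> ?N \<omega>"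
    "AE \<omega> in M. norm (?D n \<omega>) \<le> real (card (\<Phi>l \<omega> \<inter> ball 0 \<eta>))" for n
    by (rule AE_I2, fact lim) (rule AE_I2, fact bound)
  have conv: "(\<lambda>n. \<integral>\<omega>. ?D n \<omega> \<partial>M) \<longlonglongrightarrow> (\<integral>\<omega>. ?N \<omega> \<partial>M)" and int: "integrable M ?N"
    by (rule integral_dominated_convergence[OF N D dom AE]
        integrable_dominated_convergence[OF N D dom AE])+
  let ?w = "\<lambda>y::'b. p * lam_l * exp (- (p * lam_l * measure lborel (ball (0::'b) (\<beta>l * norm y)))) *
      exp (- (lam_e * measure lborel (ball y (\<beta>e * norm y))))"
  have wlim: "(\<lambda>n. indicator (ball 0 \<eta>) y * w n (g n y)) \<longlonglongrightarrow> indicator (ball 0 \<eta>) y * ?w y" for y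
    unfolding w_def by (intro tendsto_intros tendsto_measure_near tendsto_measure_exposed)
  have wbound: "norm (indicator (ball 0 \<eta>) y * w n (g n y)) \<le> p * lam_l * indicator (ball 0 \<eta>) y" for n y
  proof -
    have "w n k \<le> p * lam_l" "0 \<le> w n k" for k
    proof -
      have "exp (- (p * lam_l * measure lborel (near n k - cell n k))) *
          exp (- (lam_e * measure lborel (exposed n k))) \<le> 1"
        using p lam_l lam_e by (intro mult_le_one) simp_all
      from mult_left_le[OF this, of "p * lam_l"] show "w n k \<le> p * lam_l" "0 \<le> w n k"
        using p lam_l by (simp_all add: w_def mult.assoc)
    qed
    then show ?thesis by (auto simp: indicator_def abs_mult)
  qed
  have "(\<lambda>n. \<integral>y. indicator (ball 0 \<eta>) y * w n (g n y) \<partial>lborel) \<longlonglongrightarrow> (\<integral>y. indicator (ball 0 \<eta>) y * ?w y \<partial>lborel)"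
  proof (rule integral_dominated_convergence)
    show "(\<lambda>y. indicator (ball 0 \<eta>) y * ?w y) \<in> borel_measurable lborel"
      by (rule borel_measurable_LIMSEQ_real[OF wlim measurable_step_function])
    show "integrable lborel (\<lambda>y. p * lam_l * indicator (ball (0::'b) \<eta>) y)"
      using emeasure_bounded_finite[OF bounded_ball]
      by (intro integrable_mult_right integrable_real_indicator) simp_all
  qed (use wlim wbound measurable_step_function in auto)
  moreover have "(\<integral>y. indicator (ball 0 \<eta>) y * w n (g n y) \<partial>lborel) = (\<integral>\<omega>. ?D n \<omega> \<partial>M)" for n
    using approx[of n] by (simp add: has_bochner_integral_iff)
  ultimately have "(\<integral>\<omega>. ?N \<omega> \<partial>M) = (\<integral>y. indicator (ball 0 \<eta>) y * ?w y \<partial>lborel)"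
    using LIMSEQ_unique[OF conv] by simp
  with int show ?thesis by (simp add: has_bochner_integral_iff)
qed

section \<open>Radial integration in the plane\<close>

text \<open>A substitute for polar coordinates: under Lebesgue measure, the area of the disk spanned by a
  point is uniformly distributed.\<close>

lemma distr_area:
  fixes \<eta> :: real
  assumes "0 < \<eta>"
  shows "distr (density lborel (indicator (ball (0::real^2) \<eta>))) borel (\<lambda>y. pi * (norm y)\<^sup>2)
    = density lborel (indicator {0..pi * \<eta>\<^sup>2})" (is "?L = ?R")
\<comment> \<open>Two Borel measures on the line that are finite and equal on all rays
  \<open>{x<..}\<close> coincide.\<close>
proof (rule measure_eqI_lessThan)
  have eb: "emeasure lborel (ball (0::real^2) \<eta>) = ennreal (pi * \<eta>\<^sup>2)"
    using assms by (simp add: emeasure_ball unit_ball_vol_2)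
  have L: "emeasure ?L {x<..} = emeasure lborel (ball 0 \<eta> \<inter> {y::real^2. x < pi * (norm y)\<^sup>2})" for x
  proof -
    have "{y::real^2. x < pi * (norm y)\<^sup>2} \<in> sets borel" by measurable
    moreover have "(\<lambda>y::real^2. pi * (norm y)\<^sup>2) -` {x<..} = {y. x < pi * (norm y)\<^sup>2}" by auto
    ultimately show ?thesis
      by (subst emeasure_distr) (simp_all add: emeasure_restricted)
  qed
  have R: "emeasure ?R {x<..} = emeasure lborel ({0..pi * \<eta>\<^sup>2} \<inter> {x<..})" for x
    by (rule emeasure_restricted) auto
  show "emeasure ?L {x<..} < \<infinity>" for x
  proof -
    have "emeasure ?L {x<..} \<le> emeasure lborel (ball (0::real^2) \<eta>)"
      unfolding L by (rule emeasure_mono) auto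
    also have "\<dots> < \<infinity>" by (simp add: eb)
    finally show ?thesis .
  qed
  show "emeasure ?L {x<..} = emeasure ?R {x<..}" for x
  proof -
    \<comment> \<open>The points spanning an area above \<open>x\<close> form the whole disk, an
      annulus, or the empty set.\<close>
    consider "x < 0" | "0 \<le> x" "x < pi * \<eta>\<^sup>2" | "pi * \<eta>\<^sup>2 \<le> x" by linarith
    then show ?thesis
    proof cases
      case 1
      have "ball 0 \<eta> \<inter> {y::real^2. x < pi * (norm y)\<^sup>2} = ball 0 \<eta>"
        using 1 by (auto intro: less_le_trans)
      moreover have "{0..pi * \<eta>\<^sup>2} \<inter> {x<..} = {0..pi * \<eta>\<^sup>2}" using 1 by auto
      ultimately show ?thesis by (simp add: L R eb)
    next
      case 2
      \<comment> \<open>The radius of the disk of area \<open>x\<close>, which is the inner radius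
        of the annulus.\<close>
      define r where "r = sqrt (x / pi)"
      have r: "0 \<le> r" "x = pi * r\<^sup>2" using 2 by (auto simp: r_def)
      have "r < \<eta>"
        using 2 r assms by (intro power2_less_imp_less[of r \<eta>]) simp_all
      have xr: "x < pi * (norm y)\<^sup>2 \<longleftrightarrow> r < norm y" for y :: "real^2"
        unfolding r(2) mult_less_cancel_left_pos[OF pi_gt_zero]
        using r(1) power_mono_iff[of "norm y" r 2] by (metis norm_ge_zero not_le pos2)
      have "ball 0 \<eta> \<inter> {y::real^2. x < pi * (norm y)\<^sup>2} = ball 0 \<eta> - cball 0 r"
        by (rule set_eqI)
          (simp only: xr Int_iff Diff_iff mem_Collect_eq mem_cball_0 not_le)
      also have "emeasure lborel (ball 0 \<eta> - cball (0::real^2) r)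
          = emeasure lborel (ball (0::real^2) \<eta>) - emeasure lborel (cball (0::real^2) r)"
        using \<open>r < \<eta>\<close> r by (intro emeasure_Diff) (auto simp: emeasure_cball)
      also have "\<dots> = ennreal (pi * \<eta>\<^sup>2) - ennreal (pi * r\<^sup>2)"
        using r by (simp add: eb emeasure_cball unit_ball_vol_2)
      also have "\<dots> = ennreal (pi * \<eta>\<^sup>2 - x)" using r by (simp add: ennreal_minus)
      finally have "emeasure ?L {x<..} = ennreal (pi * \<eta>\<^sup>2 - x)" by (simp add: L)
      moreover have "{0..pi * \<eta>\<^sup>2} \<inter> {x<..} = {x<..pi * \<eta>\<^sup>2}" using 2 by auto
      ultimately show ?thesis using 2 by (simp add: R)
    next
      case 3
      have "pi * (norm y)\<^sup>2 \<le> pi * \<eta>\<^sup>2" if "norm y < \<eta>" for y :: "real^2"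
        using that by (intro mult_left_mono power_mono) auto
      then have "ball 0 \<eta> \<inter> {y::real^2. x < pi * (norm y)\<^sup>2} = {}" using 3 by fastforce
      moreover have "{0..pi * \<eta>\<^sup>2} \<inter> {x<..} = {}" using 3 by auto
      ultimately show ?thesis by (simp add: L R)
    qed
  qed
qed simp_all

text \<open>The exponential depends on \<open>y\<close> only through the area
  \<open>s = pi * (norm y)\<^sup>2\<close>, whose law is uniform by \<open>distr_area\<close>; what
  remains is the integral of \<open>exp (- (c * s))\<close> over
  \<open>{0..pi * \<eta>\<^sup>2}\<close>.\<close>

lemma integral_exp_area:
  fixes \<eta> c :: real
  assumes "0 < \<eta>" "0 < c"
  shows "(\<integral>y. indicator (ball (0::real^2) \<eta>) y * exp (- (c * (pi * (norm y)\<^sup>2))) \<partial>lborel)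
    = (1 - exp (- c * pi * \<eta>\<^sup>2)) / c"
proof -
  let ?A = "density lborel (indicator (ball (0::real^2) \<eta>))"
  have [measurable]: "ball (0::real^2) \<eta> \<in> sets borel" by simp
  have "(\<integral>y. indicator (ball (0::real^2) \<eta>) y * exp (- (c * (pi * (norm y)\<^sup>2))) \<partial>lborel)
      = (\<integral>y. exp (- (c * (pi * (norm y)\<^sup>2))) \<partial>density lborel (\<lambda>y. ennreal (indicator (ball (0::real^2) \<eta>) y)))"
    by (subst integral_density) auto
  also have "\<dots> = (\<integral>y. exp (- (c * (pi * (norm y)\<^sup>2))) \<partial>?A)"
    by (simp add: ennreal_indicator)
  also have "\<dots> = (\<integral>s. exp (- (c * s)) \<partial>distr ?A borel (\<lambda>y. pi * (norm y)\<^sup>2))"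
    by (subst integral_distr) auto
  also have "\<dots> = (\<integral>s. exp (- (c * s)) \<partial>density lborel (\<lambda>s. ennreal (indicator {0..pi * \<eta>\<^sup>2} s)))"
    by (simp add: distr_area[OF assms(1)] ennreal_indicator)
  also have "\<dots> = (\<integral>s. indicator {0..pi * \<eta>\<^sup>2} s *\<^sub>R exp (- (c * s)) \<partial>lborel)"
    by (subst integral_density) auto
  also have "\<dots> = - exp (- (c * (pi * \<eta>\<^sup>2))) / c - - exp (- (c * 0)) / c"
  proof (rule integral_FTC_Icc)
    show "((\<lambda>s. - exp (- (c * s)) / c) has_vector_derivative exp (- (c * s))) (at s within {0..pi * \<eta>\<^sup>2})" for s
      unfolding has_real_derivative_iff_has_vector_derivative[symmetric]
      using assms by (auto intro!: derivative_eq_intros)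
    show "continuous_on {0..pi * \<eta>\<^sup>2} (\<lambda>s. exp (- (c * s)))" by (intro continuous_intros)
  qed (use assms in auto)
  also have "\<dots> = (1 - exp (- c * pi * \<eta>\<^sup>2)) / c"
    by (simp add: diff_divide_distrib mult.assoc)
  finally show ?thesis .
qed

section \<open>Evaluation in the plane\<close>

theorem theorem2:
  fixes M :: "'w measure"
    and p \<eta> \<beta>l \<beta>e lam_l lam_e :: real
    and \<Phi>l \<Phi>e :: "'w \<Rightarrow> (real^2) set"
    and K :: "'w \<Rightarrow> enat" and X :: "nat \<Rightarrow> 'w \<Rightarrow> real^2" and T :: "nat \<Rightarrow> 'w \<Rightarrow> bool"
  assumes "0 < p" "p < 1" "0 < \<eta>" "0 < \<beta>l" "0 < \<beta>e" "0 \<le> lam_l" "0 \<le> lam_e"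
    and "0 < lam_l * p * \<beta>l\<^sup>2 + lam_e * \<beta>e\<^sup>2"
    and "prob_space M"
    and "prob_space.poisson_process M lam_l \<Phi>l"
    and "prob_space.poisson_process M lam_e \<Phi>e"
    and "prob_space.indep_var M config_space \<Phi>l config_space \<Phi>e"
    and "enumerates M K X \<Phi>l"
    and "prob_space.aloha_marks M p T K X \<Phi>e"
  shows "let N = (\<lambda>\<omega>. secure_in_degree \<eta> \<beta>l \<beta>e (transmitters K X T \<omega>) (\<Phi>e \<omega>) 0) in
    integrable M N \<and>
    prob_space.expectation M N =
      lam_l * p * (1 - exp (- (lam_l * p * \<beta>l\<^sup>2 + lam_e * \<beta>e\<^sup>2) * pi * \<eta>\<^sup>2)) /
        (lam_l * p * \<beta>l\<^sup>2 + lam_e * \<beta>e\<^sup>2)"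
proof -
  interpret prob_space M by fact
  interpret aloha_network M p lam_l lam_e \<Phi>l \<Phi>e K X T
    by unfold_locales (use assms in simp_all)
  define c where "c = lam_l * p * \<beta>l\<^sup>2 + lam_e * \<beta>e\<^sup>2"
  \<comment> \<open>Scaling a radius by \<beta> scales the area by its square, so both exponents are
    multiples of \<open>pi * (norm y)\<^sup>2\<close> and their coefficients add up to
    \<open>c\<close>.\<close>
  have eq: "p * lam_l * exp (- (p * lam_l * measure lborel (ball (0::real^2) (\<beta>l * norm y)))) *
      exp (- (lam_e * measure lborel (ball y (\<beta>e * norm y))))
      = lam_l * p * exp (- (c * (pi * (norm y)\<^sup>2)))" for y :: "real^2"
    using assms by (simp add: circle_area c_def power_mult_distrib algebra_simps flip: exp_add)
  have "has_bochner_integral M (\<lambda>\<omega>. secure_in_degree \<eta> \<beta>l \<beta>e (\<Phi>t \<omega>) (\<Phi>e \<omega>) 0)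
      (\<integral>y. indicator (ball (0::real^2) \<eta>) y * (lam_l * p * exp (- (c * (pi * (norm y)\<^sup>2)))) \<partial>lborel)"
    using has_bochner_integral_secure_in_degree[OF assms(4,5,7), of \<eta>] by (simp only: eq)
  also have "(\<integral>y. indicator (ball (0::real^2) \<eta>) y * (lam_l * p * exp (- (c * (pi * (norm y)\<^sup>2)))) \<partial>lborel)
      = lam_l * p * (1 - exp (- c * pi * \<eta>\<^sup>2)) / c"
    using integral_exp_area[OF assms(3), of c] assms(8)
    by (simp only: mult.left_commute[of "indicator _ _"] integral_mult_right_zero c_def times_divide_eq_right)
  finally show ?thesis
    by (simp add: has_bochner_integral_iff Let_def c_def)
qed

end
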